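(* Let $(\mathbb T^{2n},\omega)$ be the torus with the standard symplectic form. There is no $C^1$-continuous bi-invariant metric on $\mathrm{Symp}_0(\mathbb T^{2n},\omega)$.
   Context: $\mathbb T^{2n}=\mathbb R^{2n}/\mathbb Z^{2n}$ with coordinates $(x_1,\dots,x_n;y_1,\dots,y_n)$ and $\omega=\sum_i dx_i\wedge dy_i$. $\mathrm{Symp}_0(\mathbb T^{2n},\omega)$ is the identity component of the group of symplectomorphisms. A (real-valued) metric $d$ on a group $G$ is bi-invariant if $d(\theta\phi,\theta\psi)=d(\phi\theta,\psi\theta)=d(\phi,\psi)$ for all $\phi,\psi,\theta\in G$; it is identified with the function $\rho(f)=d(id,f)$. The $\rho$-topology is the topology on $G$ induced by the metric. A bi-invariant metric $\rho$ on $G=\mathrm{Symp}_0(\mathbb T^{2n},\omega)$ is $C^1$-continuous if the $C^1$-topology on $G$ is finer than the $\rho$-topology, i.e. if the identity map $(G,C^1\text{-topology})\to(G,\rho\text{-topology})$ is continuous. *)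

theory Defs
  imports "HOL-Analysis.Analysis"
begin

type_synonym 'n phase = "(real ^ 'n) \<times> (real ^ 'n)"

definition lattice :: "'n::finite phase set" where
  "lattice = {z. (\<forall>i. fst z $ i \<in> \<int>) \<and> (\<forall>i. snd z $ i \<in> \<int>)}"

definition torus_rel :: "'n::finite phase \<Rightarrow> 'n phase \<Rightarrow> bool" where
  "torus_rel z w \<longleftrightarrow> z - w \<in> lattice"

lemma equivp_torus_rel: "equivp (torus_rel :: 'n::finite phase \<Rightarrow> 'n phase \<Rightarrow> bool)"
proof (rule equivpI)
  show "reflp (torus_rel :: 'n phase \<Rightarrow> 'n phase \<Rightarrow> bool)"
    by (simp add: reflp_def torus_rel_def lattice_def)
  show "symp (torus_rel :: 'n phase \<Rightarrow> 'n phase \<Rightarrow> bool)"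
  proof (rule sympI)
    fix z w :: "'n phase"
    assume "torus_rel z w"
    then have "- (z - w) \<in> lattice"
      by (auto simp: torus_rel_def lattice_def simp del: minus_diff_eq intro: Ints_minus)
    then show "torus_rel w z" by (simp add: torus_rel_def)
  qed
  show "transp (torus_rel :: 'n phase \<Rightarrow> 'n phase \<Rightarrow> bool)"
  proof (rule transpI)
    fix x y z :: "'n phase"
    assume "torus_rel x y" "torus_rel y z"
    then have "(x - y) + (y - z) \<in> lattice"
      unfolding torus_rel_def lattice_def mem_Collect_eq fst_add snd_add vector_add_component
      by (blast intro: Ints_add)
    then show "torus_rel x z" by (simp add: torus_rel_def)
  qed
qed

text \<open>The torus is the quotient of phase space by the integer lattice; the quotient map is proj.\<close>

quotient_type 'n torus = "('n::finite) phase" / torus_rel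
  morphisms rep_torus proj
  by (rule equivp_torus_rel)

definition omega :: "'n::finite phase \<Rightarrow> 'n phase \<Rightarrow> real" where
  "omega u v = (\<Sum>i\<in>UNIV. fst u $ i * snd v $ i - snd u $ i * fst v $ i)"

text \<open>For a list of coordinate vectors this is a partial derivative of order the length of the list.\<close>

primrec iter_deriv ::
  "'a::real_normed_vector list \<Rightarrow> ('a \<Rightarrow> 'b::real_normed_vector) \<Rightarrow> 'a \<Rightarrow> 'b" where
  "iter_deriv [] F = F"
| "iter_deriv (v # vs) F = iter_deriv vs (\<lambda>x. frechet_derivative F (at x) v)"

text \<open>Differentiability of all iterated partial derivatives includes their continuity, so for open
  sets this is the usual class of infinitely differentiable maps.\<close>

definition smooth_on :: "'a::euclidean_space set \<Rightarrow> ('a \<Rightarrow> 'b::real_normed_vector) \<Rightarrow> bool" where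
  "smooth_on U F \<longleftrightarrow>
     (\<forall>vs. set vs \<subseteq> Basis \<longrightarrow> (\<forall>x\<in>U. iter_deriv vs F differentiable (at x)))"

text \<open>Local inverses of proj are the charts of the torus. Thus a smooth lift of f at z is
  f written in charts around proj z and its image. Two smooth lifts at z differ near z by a constant
  lattice vector, so the derivatives of F at z depend only on f and z.\<close>

definition smooth_lift_at ::
  "('n::finite torus \<Rightarrow> 'n torus) \<Rightarrow> 'n phase \<Rightarrow> ('n phase \<Rightarrow> 'n phase) \<Rightarrow> bool" where
  "smooth_lift_at f z F \<longleftrightarrow>
     (\<exists>U. open U \<and> z \<in> U \<and> smooth_on U F \<and> (\<forall>x\<in>U. proj (F x) = f (proj x)))"

definition smooth_map :: "('n::finite torus \<Rightarrow> 'n torus) \<Rightarrow> bool" where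
  "smooth_map f \<longleftrightarrow> (\<forall>z. \<exists>F. smooth_lift_at f z F)"

definition preserves_omega :: "('n::finite torus \<Rightarrow> 'n torus) \<Rightarrow> bool" where
  "preserves_omega f \<longleftrightarrow>
     (\<forall>z F. smooth_lift_at f z F \<longrightarrow>
        (\<forall>u v. omega (frechet_derivative F (at z) u) (frechet_derivative F (at z) v) = omega u v))"

definition Symp :: "('n::finite torus \<Rightarrow> 'n torus) set" where
  "Symp = {f. bij f \<and> smooth_map f \<and> smooth_map (inv f) \<and> preserves_omega f}"

text \<open>The flat distance of f (proj z) and g (proj z) is less than e iff the two points have lifts at
  distance less than e. So the empty list of directions accounts for the uniform distance of
  f and g, and the lists of length between 1 and r for their derivatives up to order r.\<close>

definition Cr_close ::
  "nat \<Rightarrow> real \<Rightarrow> ('n::finite torus \<Rightarrow> 'n torus) \<Rightarrow> ('n torus \<Rightarrow> 'n torus) \<Rightarrow> bool" where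
  "Cr_close r e f g \<longleftrightarrow>
     (\<forall>z. \<exists>F G. smooth_lift_at f z F \<and> smooth_lift_at g z G \<and>
        (\<forall>vs. length vs \<le> r \<and> set vs \<subseteq> Basis \<longrightarrow>
           norm (iter_deriv vs F z - iter_deriv vs G z) < e))"

definition Cr_topology :: "nat \<Rightarrow> ('n::finite torus \<Rightarrow> 'n torus) topology" where
  "Cr_topology r = topology (\<lambda>U. U \<subseteq> Symp \<and>
     (\<forall>f\<in>U. \<exists>e>0. \<forall>g\<in>Symp. Cr_close r e f g \<longrightarrow> g \<in> U))"

definition Cinf_topology :: "('n::finite torus \<Rightarrow> 'n torus) topology" where
  "Cinf_topology = topology (\<lambda>U. U \<subseteq> Symp \<and>
     (\<forall>f\<in>U. \<exists>r. \<exists>e>0. \<forall>g\<in>Symp. Cr_close r e f g \<longrightarrow> g \<in> U))"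

lemma Cr_close_mono:
  assumes "Cr_close r e f g" "r' \<le> r" "e \<le> e'"
  shows "Cr_close r' e' f g"
  unfolding Cr_close_def
proof
  fix z
  obtain F G where FG: "smooth_lift_at f z F" "smooth_lift_at g z G"
    and *: "\<forall>vs. length vs \<le> r \<and> set vs \<subseteq> Basis \<longrightarrow>
              norm (iter_deriv vs F z - iter_deriv vs G z) < e"
    using assms(1) unfolding Cr_close_def by blast
  have "\<forall>vs. length vs \<le> r' \<and> set vs \<subseteq> Basis \<longrightarrow>
          norm (iter_deriv vs F z - iter_deriv vs G z) < e'"
    using * assms(2,3) by (meson le_trans less_le_trans)
  with FG show "\<exists>F G. smooth_lift_at f z F \<and> smooth_lift_at g z G \<and>
      (\<forall>vs. length vs \<le> r' \<and> set vs \<subseteq> Basis \<longrightarrow>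
         norm (iter_deriv vs F z - iter_deriv vs G z) < e')"
    by blast
qed

lemma openin_Cr_topology:
  "openin (Cr_topology r) U \<longleftrightarrow>
     U \<subseteq> Symp \<and> (\<forall>f\<in>U. \<exists>e>0. \<forall>g\<in>Symp. Cr_close r e f g \<longrightarrow> g \<in> U)"
proof -
  have "istopology (\<lambda>U. U \<subseteq> Symp \<and> (\<forall>f\<in>U. \<exists>e>0. \<forall>g\<in>Symp. Cr_close r e f g \<longrightarrow> g \<in> U))"
    (is "istopology ?P")
    unfolding istopology_def
  proof (intro conjI allI impI)
    fix S T assume S: "?P S" and T: "?P T"
    then show "S \<inter> T \<subseteq> Symp" by blast
    show "\<forall>f\<in>S \<inter> T. \<exists>e>0. \<forall>g\<in>Symp. Cr_close r e f g \<longrightarrow> g \<in> S \<inter> T"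
    proof
      fix f assume "f \<in> S \<inter> T"
      with S T obtain d e where *:
        "d > 0" "\<forall>g\<in>Symp. Cr_close r d f g \<longrightarrow> g \<in> S"
        "e > 0" "\<forall>g\<in>Symp. Cr_close r e f g \<longrightarrow> g \<in> T" by blast
      have "Cr_close r d f g \<and> Cr_close r e f g" if "Cr_close r (min d e) f g" for g
        using Cr_close_mono[OF that] by simp
      with * show "\<exists>e>0. \<forall>g\<in>Symp. Cr_close r e f g \<longrightarrow> g \<in> S \<inter> T"
        by (intro exI[of _ "min d e"]) auto
    qed
  next
    fix K assume K: "\<forall>U\<in>K. ?P U"
    then show "\<Union>K \<subseteq> Symp" by blast
    show "\<forall>f\<in>\<Union>K. \<exists>e>0. \<forall>g\<in>Symp. Cr_close r e f g \<longrightarrow> g \<in> \<Union>K"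
      using K by (meson UnionE UnionI)
  qed
  from fun_cong[OF topology_inverse'[OF this]] show ?thesis unfolding Cr_topology_def .
qed

lemma openin_Cinf_topology:
  "openin Cinf_topology U \<longleftrightarrow>
     U \<subseteq> Symp \<and> (\<forall>f\<in>U. \<exists>r. \<exists>e>0. \<forall>g\<in>Symp. Cr_close r e f g \<longrightarrow> g \<in> U)"
proof -
  have "istopology (\<lambda>U. U \<subseteq> Symp \<and> (\<forall>f\<in>U. \<exists>r. \<exists>e>0. \<forall>g\<in>Symp. Cr_close r e f g \<longrightarrow> g \<in> U))"
    (is "istopology ?P")
    unfolding istopology_def
  proof (intro conjI allI impI)
    fix S T assume S: "?P S" and T: "?P T"
    then show "S \<inter> T \<subseteq> Symp" by blast
    show "\<forall>f\<in>S \<inter> T. \<exists>r. \<exists>e>0. \<forall>g\<in>Symp. Cr_close r e f g \<longrightarrow> g \<in> S \<inter> T"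
    proof
      fix f assume "f \<in> S \<inter> T"
      with S T obtain q d r e where *:
        "d > 0" "\<forall>g\<in>Symp. Cr_close q d f g \<longrightarrow> g \<in> S"
        "e > 0" "\<forall>g\<in>Symp. Cr_close r e f g \<longrightarrow> g \<in> T" by blast
      have "Cr_close q d f g \<and> Cr_close r e f g" if "Cr_close (max q r) (min d e) f g" for g
        using Cr_close_mono[OF that] by simp
      with * show "\<exists>r. \<exists>e>0. \<forall>g\<in>Symp. Cr_close r e f g \<longrightarrow> g \<in> S \<inter> T"
        by (intro exI[of _ "max q r"] exI[of _ "min d e"]) auto
    qed
  next
    fix K assume K: "\<forall>U\<in>K. ?P U"
    then show "\<Union>K \<subseteq> Symp" by blast
    show "\<forall>f\<in>\<Union>K. \<exists>r. \<exists>e>0. \<forall>g\<in>Symp. Cr_close r e f g \<longrightarrow> g \<in> \<Union>K"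
      using K by (meson UnionE UnionI)
  qed
  from fun_cong[OF topology_inverse'[OF this]] show ?thesis unfolding Cinf_topology_def .
qed

text \<open>As usual, the identity component is taken in the topology of uniform convergence of all
  derivatives.\<close>

definition Symp0 :: "('n::finite torus \<Rightarrow> 'n torus) set" where
  "Symp0 = connected_component_of_set Cinf_topology id"

definition bi_invariant :: "('a \<Rightarrow> 'a) metric \<Rightarrow> bool" where
  "bi_invariant m \<longleftrightarrow>
     (\<forall>\<phi>\<in>mspace m. \<forall>\<psi>\<in>mspace m. \<forall>\<theta>\<in>mspace m.
        mdist m (\<theta> \<circ> \<phi>) (\<theta> \<circ> \<psi>) = mdist m \<phi> \<psi> \<and>
        mdist m (\<phi> \<circ> \<theta>) (\<psi> \<circ> \<theta>) = mdist m \<phi> \<psi>)"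

definition C1_continuous :: "('n::finite torus \<Rightarrow> 'n torus) metric \<Rightarrow> bool" where
  "C1_continuous m \<longleftrightarrow>
     continuous_map (subtopology (Cr_topology 1) (mspace m)) (mtopology_of m) (\<lambda>f. f)"

end

theory Submission imports Defs
begin

text \<open>A small translation \<open>T\<close> along a coordinate \<open>x\<^sub>i\<close> is close to the identity, so every commutator
  with \<open>T\<close> has small norm. The commutator of the translation by \<open>a\<close> with the shear
  \<open>y\<^sub>i \<mapsto> y\<^sub>i + \<phi>(x\<^sub>i)\<close> is the shear by \<open>\<phi>(x\<^sub>i + a) - \<phi>(x\<^sub>i)\<close>. For every small \<open>a > 0\<close> there is a
  trigonometric \<open>\<phi>\<close>, of amplitude about \<open>1/a\<close>, for which this difference is the fixed function
  \<open>cos (2 \<pi> x\<^sub>i) / 2\<close>. So the shear by this function is at distance 0 from the identity.\<close>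

section \<open>Drift shears and their descent to the torus\<close>

text \<open>A single family holds the translations (\<open>A = 0\<close>), the shears
  (\<open>a = 0\<close>) and the products of the two, so smoothness, symplecticity and isotopy to
  the identity are shown once for all of them. The wave is evaluated at the position before the
  drift.\<close>

definition drift_shear :: "'n \<Rightarrow> real \<Rightarrow> real \<Rightarrow> real \<Rightarrow> 'n::finite phase \<Rightarrow> 'n phase" where
  "drift_shear i a A d z =
     z + a *\<^sub>R (axis i 1, 0) + (A * sin (2 * pi * fst z $ i + d)) *\<^sub>R (0, axis i 1)"

definition torus_drift_shear :: "'n \<Rightarrow> real \<Rightarrow> real \<Rightarrow> real \<Rightarrow> 'n::finite torus \<Rightarrow> 'n torus" where
  "torus_drift_shear i a A d p = proj (drift_shear i a A d (rep_torus p))"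

lemma proj_eq_iff: "proj z = proj w \<longleftrightarrow> z - w \<in> lattice"
  using Quotient3_rel[OF Quotient3_torus, of z w] equivp_torus_rel
  by (auto simp: torus_rel_def lattice_def)

lemma proj_rep_torus [simp]: "proj (rep_torus p) = p"
  by (rule Quotient3_abs_rep[OF Quotient3_torus])

text \<open>Each coordinate is an integer of absolute value below 1. This discreteness makes the
  difference of two continuous lifts locally constant.\<close>

lemma lattice_small:
  assumes "c \<in> (lattice :: 'n::finite phase set)" "norm c < 1"
  shows "c = 0"
proof -
  have "norm (fst c) < 1" "norm (snd c) < 1"
    using assms(2) norm_fst_le[of "fst c" "snd c"] norm_snd_le[of "snd c" "fst c"] by auto
  then have "\<bar>fst c $ i\<bar> < 1" "\<bar>snd c $ i\<bar> < 1" for i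
    using component_le_norm_cart[of "fst c" i] component_le_norm_cart[of "snd c" i] by auto
  moreover have "fst c $ i \<in> \<int>" "snd c $ i \<in> \<int>" for i
    using assms(1) by (auto simp: lattice_def)
  ultimately have "fst c $ i = 0" "snd c $ i = 0" for i
    by (metis Ints_nonzero_abs_less1)+
  then show ?thesis by (simp add: prod_eq_iff vec_eq_iff)
qed

lemma sin_shift_int:
  assumes "x - y \<in> \<int>"
  shows "sin (2 * pi * x + d) = sin (2 * pi * y + d)"
proof -
  obtain n where n: "x = y + of_int n"
    using assms by (metis Ints_cases add.commute diff_add_cancel)
  have "2 * pi * x + d = 2 * pi * y + d + 2 * pi * of_int n"
    unfolding n by (simp add: algebra_simps)
  then show ?thesis
    by (simp only: sin_add[of _ "2 * pi * of_int n"] sin_int_2pin cos_int_2pin)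
qed

text \<open>The wave has period 1 in the coordinate \<open>i\<close>, so a drift shear commutes with
  lattice translations and the chosen representative does not matter.\<close>

lemma proj_drift_shear:
  "proj (drift_shear i a A d z) = torus_drift_shear i a A d (proj z)"
proof -
  define w where "w = rep_torus (proj z)"
  have l: "z - w \<in> lattice" unfolding w_def by (simp flip: proj_eq_iff)
  then have "sin (2 * pi * fst z $ i + d) = sin (2 * pi * fst w $ i + d)"
    by (intro sin_shift_int) (auto simp: lattice_def)
  then have "drift_shear i a A d z - drift_shear i a A d w = z - w"
    by (simp add: drift_shear_def)
  with l show ?thesis
    by (simp add: torus_drift_shear_def proj_eq_iff flip: w_def)
qed

text \<open>The second map sees the coordinate already moved by \<open>a\<close>; lowering its phase
  by \<open>2 * pi * a\<close> brings both waves into phase, so their amplitudes add.\<close>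

lemma drift_shear_comp:
  "drift_shear i b B (d - 2 * pi * a) (drift_shear i a A d z) = drift_shear i (a + b) (A + B) d z"
  by (simp add: drift_shear_def algebra_simps)

lemma torus_map_eqI:
  assumes "\<And>z. f (proj z) = g (proj z)"
  shows "f = g"
  using assms[of "rep_torus _"] by (intro ext) simp

lemma torus_drift_shear_comp:
  "torus_drift_shear i b B (d - 2 * pi * a) \<circ> torus_drift_shear i a A d
     = torus_drift_shear i (a + b) (A + B) d"
  by (rule torus_map_eqI) (simp add: drift_shear_comp flip: proj_drift_shear)

lemma torus_drift_shear_0 [simp]: "torus_drift_shear i 0 0 d = id"
  by (rule ext) (simp add: torus_drift_shear_def drift_shear_def flip: zero_prod_def)

lemma torus_drift_shear_inverse:
  "torus_drift_shear i (- a) (- A) (d - 2 * pi * a) \<circ> torus_drift_shear i a A d = id"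
  "torus_drift_shear i a A d \<circ> torus_drift_shear i (- a) (- A) (d - 2 * pi * a) = id"
  using torus_drift_shear_comp[of i "- a" "- A" d a A]
    torus_drift_shear_comp[of i a A "d - 2 * pi * a" "- a" "- A"]
  by simp_all

lemma bij_torus_drift_shear: "bij (torus_drift_shear i a A d)"
  using torus_drift_shear_inverse by (rule o_bij)

lemma inv_torus_drift_shear:
  "inv (torus_drift_shear i a A d) = torus_drift_shear i (- a) (- A) (d - 2 * pi * a)"
  using torus_drift_shear_inverse by (rule inv_unique_comp[rotated])

section \<open>Iterated derivatives and smoothness\<close>

text \<open>The cosine is written as a sine with phase advanced by \<open>pi / 2\<close>. The
  derivative in a fixed direction is then a wave of the same form, which lets differentiation be
  iterated by induction.\<close>

lemma has_derivative_sine_wave: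
  fixes z :: "'n::finite phase"
  shows "((\<lambda>x. b + (B * sin (2 * pi * fst x $ i + d)) *\<^sub>R c) has_derivative
     (\<lambda>v. (B * (2 * pi * fst v $ i) * sin (2 * pi * fst z $ i + (d + pi / 2))) *\<^sub>R c)) (at z)"
proof -
  have i: "((\<lambda>x :: 'n phase. fst x $ i) has_derivative (\<lambda>v. fst v $ i)) (at z)"
    by (intro bounded_linear.has_derivative[OF bounded_linear_vec_nth] derivative_intros)
  have "sin (2 * pi * fst z $ i + (d + pi / 2)) = cos (2 * pi * fst z $ i + d)"
    by (simp add: add.assoc[symmetric] sin_add[of _ "pi / 2"])
  then show ?thesis
    by (auto intro!: derivative_eq_intros i simp: algebra_simps)
qed

lemma frechet_derivative_sine_wave:
  "frechet_derivative (\<lambda>x :: 'n::finite phase. b + (B * sin (2 * pi * fst x $ i + d)) *\<^sub>R c) (at z) v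
     = (B * (2 * pi * fst v $ i) * sin (2 * pi * fst z $ i + (d + pi / 2))) *\<^sub>R c"
  by (simp only: frechet_derivative_at[OF has_derivative_sine_wave, symmetric])

lemma iter_deriv_sine_wave:
  "iter_deriv vs (\<lambda>x :: 'n::finite phase. b + (B * sin (2 * pi * fst x $ i + d)) *\<^sub>R c) =
     (\<lambda>z. (if vs = [] then b else 0) +
       (B * (\<Prod>v\<leftarrow>vs. 2 * pi * fst v $ i) * sin (2 * pi * fst z $ i + (d + length vs * (pi / 2)))) *\<^sub>R c)"
proof (induction vs arbitrary: b B d)
  case (Cons v vs)
  have phase: "d + pi / 2 + length vs * (pi / 2) = d + length (v # vs) * (pi / 2)"
    by (simp add: field_simps)
  show ?case
    using Cons[of 0 "B * (2 * pi * fst v $ i)" "d + pi / 2"]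
    unfolding iter_deriv.simps frechet_derivative_sine_wave phase
    by (simp add: mult.assoc)
qed simp

lemma has_derivative_drift_shear:
  "(drift_shear i a A d has_derivative
     (\<lambda>v. v + (A * (2 * pi * fst v $ i) * sin (2 * pi * fst z $ i + (d + pi / 2))) *\<^sub>R (0, axis i 1)))
     (at z)"
proof -
  have "drift_shear i a A d =
      (\<lambda>x. x + (a *\<^sub>R (axis i 1, 0) + (A * sin (2 * pi * fst x $ i + d)) *\<^sub>R (0, axis i 1)))"
    by (rule ext) (simp only: drift_shear_def add.assoc)
  then show ?thesis
    using has_derivative_add[OF has_derivative_ident
      has_derivative_sine_wave[of "a *\<^sub>R (axis i 1, 0)" A i d "(0, axis i 1)" z]]
    by (simp only:)
qed

text \<open>The \<open>case\<close> term collects the derivatives of the affine part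
  \<open>z + a *\<^sub>R (axis i 1, 0)\<close>. After one derivative only a constant plus a wave
  remains, to which \<open>iter_deriv_sine_wave\<close> applies.\<close>

lemma iter_deriv_drift_shear:
  "iter_deriv vs (drift_shear i a A d) =
     (\<lambda>z. (case vs of [] \<Rightarrow> z + a *\<^sub>R (axis i 1, 0) | [v] \<Rightarrow> v | _ \<Rightarrow> 0) +
       (A * (\<Prod>v\<leftarrow>vs. 2 * pi * fst v $ i) * sin (2 * pi * fst z $ i + (d + length vs * (pi / 2))))
         *\<^sub>R (0, axis i 1))"
proof (cases vs)
  case Nil
  then show ?thesis by (simp add: drift_shear_def fun_eq_iff)
next
  case (Cons v us)
  have "frechet_derivative (drift_shear i a A d) (at z) v =
      v + (A * (2 * pi * fst v $ i) * sin (2 * pi * fst z $ i + (d + pi / 2))) *\<^sub>R (0, axis i 1)"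
    for z
    by (simp only: frechet_derivative_at[OF has_derivative_drift_shear, symmetric])
  moreover have "d + pi / 2 + length us * (pi / 2) = d + length vs * (pi / 2)"
    by (simp add: Cons field_simps)
  ultimately show ?thesis
    unfolding Cons iter_deriv.simps
    by (simp only: iter_deriv_sine_wave) (simp add: mult.assoc split: list.split)
qed

lemma smooth_on_drift_shear: "smooth_on UNIV (drift_shear i a A d)"
  unfolding smooth_on_def
proof (intro allI impI ballI)
  fix vs :: "'a phase list" and z
  show "iter_deriv vs (drift_shear i a A d) differentiable at z"
  proof (cases vs)
    case Nil
    then show ?thesis
      unfolding Nil differentiable_def iter_deriv.simps using has_derivative_drift_shear by blast
  next
    case (Cons v us)
    show ?thesis
      unfolding iter_deriv_drift_shear Cons differentiable_def
      \<comment> \<open>The split on \<open>us\<close> fixes the constant as \<open>v\<close> or 0;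
        what is left is a sine wave.\<close>
      by (cases us) (simp_all only: list.case, (rule exI has_derivative_sine_wave)+)
  qed
qed

lemma smooth_lift_drift_shear:
  "smooth_lift_at (torus_drift_shear i a A d) z (drift_shear i a A d)"
  unfolding smooth_lift_at_def
  by (rule exI[of _ UNIV]) (simp add: smooth_on_drift_shear proj_drift_shear)

lemma smooth_map_torus_drift_shear: "smooth_map (torus_drift_shear i a A d)"
  unfolding smooth_map_def by (rule allI exI smooth_lift_drift_shear)+

section \<open>Preservation of the symplectic form\<close>

lemma smooth_lift_at_differentiable:
  assumes "smooth_lift_at f z F"
  obtains U where "open U" "z \<in> U" "\<And>x. x \<in> U \<Longrightarrow> F differentiable (at x)"
    "\<And>x. x \<in> U \<Longrightarrow> proj (F x) = f (proj x)"
proof -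
  from assms obtain U where U: "open U" "z \<in> U" "smooth_on U F" "\<forall>x\<in>U. proj (F x) = f (proj x)"
    unfolding smooth_lift_at_def by blast
  have "F differentiable (at x)" if "x \<in> U" for x
    using U(3)[unfolded smooth_on_def, rule_format, of "[]"] that by simp
  with U that show thesis by blast
qed

text \<open>The difference of two lifts is continuous at \<open>z\<close> and takes lattice values
  nearby, hence is constant near \<open>z\<close>. Since \<open>preserves_omega\<close> ranges over
  all lifts, this reduces it to the explicit lift \<open>drift_shear\<close>.\<close>

lemma smooth_lifts_same_derivative:
  assumes "smooth_lift_at f z F" "smooth_lift_at f z G"
  shows "frechet_derivative F (at z) = frechet_derivative G (at z)"
proof -
  obtain U where U: "open U" "z \<in> U" "\<And>x. x \<in> U \<Longrightarrow> F differentiable (at x)"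
    "\<And>x. x \<in> U \<Longrightarrow> proj (F x) = f (proj x)"
    using smooth_lift_at_differentiable[OF assms(1)] by blast
  obtain V where V: "open V" "z \<in> V" "\<And>x. x \<in> V \<Longrightarrow> G differentiable (at x)"
    "\<And>x. x \<in> V \<Longrightarrow> proj (G x) = f (proj x)"
    using smooth_lift_at_differentiable[OF assms(2)] by blast
  define H where "H x = F x - G x" for x
  have Hl: "H x \<in> lattice" if "x \<in> U \<inter> V" for x
    using U(4) V(4) that by (simp add: H_def flip: proj_eq_iff)
  have "isCont H z"
    unfolding H_def using U V by (intro continuous_intros differentiable_imp_continuous_within) auto
  then have "\<forall>\<^sub>F x in at z. dist (H x) (H z) < 1"
    unfolding isCont_def by (intro tendstoD) auto
  moreover have "\<forall>\<^sub>F x in at z. x \<in> U \<inter> V"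
    using U V by (intro eventually_at_in_open') auto
  ultimately have ev: "\<forall>\<^sub>F x in at z. F x = G x + H z"
  proof eventually_elim
    case (elim x)
    have "H x - H z \<in> lattice"
      using Hl[of x] Hl[of z] U(2) V(2) elim(2) by (auto simp: lattice_def)
    with elim(1) have "H x - H z = 0" by (intro lattice_small) (auto simp: dist_norm)
    then show ?case by (simp add: H_def algebra_simps)
  qed
  have "(G has_derivative frechet_derivative G (at z)) (at z)"
    using V by (simp flip: frechet_derivative_works)
  then have "((\<lambda>x. G x + H z) has_derivative frechet_derivative G (at z)) (at z)"
    by (auto intro!: derivative_eq_intros)
  \<comment> \<open>\<open>ev\<close> covers only a punctured neighbourhood; at \<open>z\<close>
    itself the equality is the definition of \<open>H\<close>.\<close>
  then have "(F has_derivative frechet_derivative G (at z)) (at z)"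
    by (rule has_derivative_transform_eventually)
      (use ev in \<open>auto simp: H_def elim: eventually_mono\<close>)
  then show ?thesis by (simp only: frechet_derivative_at[symmetric])
qed

text \<open>The correction adds \<open>c * fst u $ i * fst v $ i\<close> to the \<open>i\<close>-th
  summand twice, with opposite signs.\<close>

lemma omega_drift_shear:
  "omega (u + (c * fst u $ i) *\<^sub>R (0, axis i 1)) (v + (c * fst v $ i) *\<^sub>R (0, axis i 1)) = omega u v"
  unfolding omega_def
  by (intro sum.cong) (auto simp: axis_def algebra_simps)

lemma preserves_omega_torus_drift_shear: "preserves_omega (torus_drift_shear i a A d)"
  unfolding preserves_omega_def
proof (intro allI impI)
  fix z F and u v :: "'a phase"
  assume "smooth_lift_at (torus_drift_shear i a A d) z F"
  then have "frechet_derivative F (at z) = frechet_derivative (drift_shear i a A d) (at z)"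
    using smooth_lift_drift_shear by (rule smooth_lifts_same_derivative)
  also have "\<dots> = (\<lambda>v. v + ((A * 2 * pi * sin (2 * pi * fst z $ i + (d + pi / 2))) * fst v $ i)
      *\<^sub>R (0, axis i 1))"
    using frechet_derivative_at[OF has_derivative_drift_shear[of i a A d z]]
    by (simp add: algebra_simps)
  finally show "omega (frechet_derivative F (at z) u) (frechet_derivative F (at z) v) = omega u v"
    by (simp only: omega_drift_shear)
qed

lemma torus_drift_shear_in_Symp: "torus_drift_shear i a A d \<in> Symp"
  by (simp add: Symp_def bij_torus_drift_shear inv_torus_drift_shear
      smooth_map_torus_drift_shear preserves_omega_torus_drift_shear)

section \<open>Closeness estimates and the identity component\<close>

text \<open>With a common phase the two waves differ only in amplitude, and each derivative along a
  basis vector enlarges the bound by a factor of at most \<open>2 * pi\<close>. The drifts differ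
  only at order 0.\<close>

lemma Cr_close_torus_drift_shear:
  assumes "\<bar>a - b\<bar> + \<bar>A - B\<bar> * (2 * pi) ^ r < e"
  shows "Cr_close r e (torus_drift_shear i a A d :: 'n::finite torus \<Rightarrow> _) (torus_drift_shear i b B d)"
  unfolding Cr_close_def
proof (intro allI exI conjI impI)
  fix z :: "'n phase" and vs :: "'n phase list"
  show "smooth_lift_at (torus_drift_shear i a A d) z (drift_shear i a A d)"
    "smooth_lift_at (torus_drift_shear i b B d) z (drift_shear i b B d)"
    by (rule smooth_lift_drift_shear)+
  assume vs: "length vs \<le> r \<and> set vs \<subseteq> Basis"
  have P: "\<bar>\<Prod>v\<leftarrow>vs. 2 * pi * fst v $ i\<bar> \<le> (2 * pi) ^ length vs"
    if "set vs \<subseteq> Basis" for vs :: "'n phase list"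
    using that
  proof (induction vs)
    case (Cons v vs)
    have "\<bar>fst v $ i\<bar> \<le> norm v"
      using component_le_norm_cart[of "fst v" i] norm_fst_le[of "fst v" "snd v"] by simp
    then have "\<bar>2 * pi * fst v $ i\<bar> \<le> 2 * pi"
      using Cons.prems by (simp add: abs_mult)
    with Cons show ?case by (simp add: abs_mult mult_mono del: mult_le_cancel_left1)
  qed simp
  \<comment> \<open>As the base is at least 1, the bound for order \<open>r\<close> covers all lower
    orders.\<close>
  have "1 \<le> 2 * pi" using pi_ge_two by linarith
  then have P: "\<bar>\<Prod>v\<leftarrow>vs. 2 * pi * fst v $ i\<bar> \<le> (2 * pi) ^ r"
    using P[of vs] vs power_increasing[of "length vs" r "2 * pi"] by force
  define s where "s = sin (2 * pi * fst z $ i + (d + length vs * (pi / 2)))"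
  have s: "\<bar>s\<bar> \<le> 1" by (simp add: s_def)
  have "iter_deriv vs (drift_shear i a A d) z - iter_deriv vs (drift_shear i b B d) z =
     (if vs = [] then a - b else 0) *\<^sub>R (axis i 1, 0)
     + ((A - B) * (\<Prod>v\<leftarrow>vs. 2 * pi * fst v $ i) * s) *\<^sub>R (0, axis i 1)"
    unfolding iter_deriv_drift_shear s_def[symmetric]
    by (simp add: algebra_simps split: list.split)
  also have "norm \<dots> \<le> \<bar>a - b\<bar> + \<bar>(A - B) * (\<Prod>v\<leftarrow>vs. 2 * pi * fst v $ i) * s\<bar>"
    by (rule norm_triangle_le) (auto simp: norm_Pair)
  also have "\<bar>(A - B) * (\<Prod>v\<leftarrow>vs. 2 * pi * fst v $ i) * s\<bar> \<le> \<bar>A - B\<bar> * (2 * pi) ^ r * 1"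
    unfolding abs_mult using P s by (intro mult_mono) auto
  finally show "norm (iter_deriv vs (drift_shear i a A d) z - iter_deriv vs (drift_shear i b B d) z) < e"
    using assms by simp
qed

lemma topspace_Cinf_topology: "topspace Cinf_topology = Symp"
proof
  show "topspace Cinf_topology \<subseteq> Symp"
    using openin_topspace[of Cinf_topology] unfolding openin_Cinf_topology by blast
  have "openin Cinf_topology Symp"
    unfolding openin_Cinf_topology by (auto intro: exI[of _ 1])
  then show "Symp \<subseteq> topspace Cinf_topology" by (rule openin_subset)
qed

text \<open>Scaling drift and amplitude by \<open>t\<close>, with the phase held fixed, gives a path
  from the identity that is continuous for the topology of all derivatives.\<close>

lemma torus_drift_shear_in_Symp0:
  "(torus_drift_shear i a A d :: 'n::finite torus \<Rightarrow> _) \<in> Symp0"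
proof -
  define \<gamma> :: "real \<Rightarrow> 'n torus \<Rightarrow> 'n torus"
    where "\<gamma> t = torus_drift_shear i (t * a) (t * A) d" for t
  have "continuous_map euclideanreal Cinf_topology \<gamma>"
    unfolding continuous_map_def
  proof (intro conjI allI impI)
    show "\<gamma> \<in> topspace euclideanreal \<rightarrow> topspace Cinf_topology"
      by (auto simp: topspace_Cinf_topology \<gamma>_def torus_drift_shear_in_Symp)
    fix U :: "('n torus \<Rightarrow> 'n torus) set"
    assume U: "openin Cinf_topology U"
    have "\<exists>T. open T \<and> t \<in> T \<and> T \<subseteq> {t. \<gamma> t \<in> U}" if "\<gamma> t \<in> U" for t
    proof -
      have "\<exists>r. \<exists>e>0. \<forall>g\<in>Symp. Cr_close r e (\<gamma> t) g \<longrightarrow> g \<in> U"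
        using U[unfolded openin_Cinf_topology, THEN conjunct2] that by (rule bspec)
      then obtain r e where e: "e > 0" "\<And>g. g \<in> Symp \<Longrightarrow> Cr_close r e (\<gamma> t) g \<Longrightarrow> g \<in> U"
        by metis
      \<comment> \<open>These are the parameters for which \<open>Cr_close_torus_drift_shear\<close>
        applies; the set is open because its defining bound is continuous in
        \<open>s\<close>.\<close>
      define T where "T = {s. \<bar>t * a - s * a\<bar> + \<bar>t * A - s * A\<bar> * (2 * pi) ^ r < e}"
      have "open T" unfolding T_def by (intro open_Collect_less continuous_intros)
      moreover have "t \<in> T" using e(1) by (simp add: T_def)
      moreover have "\<gamma> s \<in> U" if "s \<in> T" for s
      proof (rule e(2))
        show "\<gamma> s \<in> Symp" unfolding \<gamma>_def by (rule torus_drift_shear_in_Symp)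
        show "Cr_close r e (\<gamma> t) (\<gamma> s)"
          unfolding \<gamma>_def using that
          by (intro Cr_close_torus_drift_shear) (simp only: T_def mem_Collect_eq)
      qed
      ultimately show ?thesis by blast
    qed
    then have "open {t. \<gamma> t \<in> U}" by (subst open_subopen) blast
    then show "openin euclideanreal {t \<in> topspace euclideanreal. \<gamma> t \<in> U}" by simp
  qed
  then have "connectedin Cinf_topology (range \<gamma>)"
    by (rule connectedin_continuous_map_image) (simp add: connected_UNIV)
  moreover have "\<gamma> 0 = id" "\<gamma> 1 = torus_drift_shear i a A d"
    by (simp_all add: \<gamma>_def)
  ultimately show ?thesis
    unfolding Symp0_def connected_component_of_def mem_Collect_eq by (metis rangeI)
qed

lemma id_in_Symp0: "id \<in> Symp0"
  using torus_drift_shear_in_Symp0[of undefined 0 0 0] by simp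

section \<open>The commutator estimate\<close>

lemma mdist_translation_small:
  fixes \<rho> :: "('n::finite torus \<Rightarrow> 'n torus) metric"
  assumes "mspace \<rho> = Symp0" "C1_continuous \<rho>" "e > 0"
  obtains a where "0 < a" "a < 1" "mdist \<rho> id (torus_drift_shear i a 0 0) < e"
proof -
  have id: "id \<in> mspace \<rho>" by (simp add: assms(1) id_in_Symp0)
  let ?X = "subtopology (Cr_topology 1) (mspace \<rho>)"
  let ?W = "{f \<in> topspace ?X. f \<in> mball_of \<rho> id e}"
  have "openin (mtopology_of \<rho>) (mball_of \<rho> id e)"
    unfolding mtopology_of_def mball_of_def by (rule Metric_space.openin_mball) simp
  then have "openin ?X ?W"
    using assms(2) unfolding C1_continuous_def continuous_map_def by blast
  then obtain U where U: "openin (Cr_topology 1) U" "?W = U \<inter> mspace \<rho>"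
    unfolding openin_subtopology by blast
  have Symp: "openin (Cr_topology 1) (Symp :: ('n torus \<Rightarrow> 'n torus) set)"
    unfolding openin_Cr_topology by (auto intro: exI[of _ 1])
  have "id \<in> (Symp :: ('n torus \<Rightarrow> 'n torus) set)"
    using torus_drift_shear_in_Symp[of i 0 0 0] by simp
  moreover have "mdist \<rho> id id < e"
    using assms(3) by (simp only: mdist_zero[OF id id, THEN iffD2, OF refl])
  ultimately have "id \<in> ?W"
    using id openin_subset[OF Symp] by auto
  then obtain \<delta> where \<delta>: "\<delta> > 0" "\<And>g. g \<in> Symp \<Longrightarrow> Cr_close 1 \<delta> id g \<Longrightarrow> g \<in> U"
    using U unfolding openin_Cr_topology by blast
  \<comment> \<open>The bound by \<open>\<delta>\<close> gives closeness to the identity;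
    \<open>a < 1\<close> will keep \<open>sin (pi * a)\<close> positive.\<close>
  define a where "a = min \<delta> 1 / 2"
  have a: "0 < a" "a < 1" "a < \<delta>" using \<delta>(1) by (auto simp: a_def min_def)
  then have "Cr_close 1 \<delta> (torus_drift_shear i 0 0 0) (torus_drift_shear i a 0 0)"
    by (intro Cr_close_torus_drift_shear) simp
  then have "torus_drift_shear i a 0 0 \<in> U \<inter> mspace \<rho>"
    using \<delta>(2) by (simp add: torus_drift_shear_in_Symp torus_drift_shear_in_Symp0 assms(1))
  then have "mdist \<rho> id (torus_drift_shear i a 0 0) < e"
    unfolding U(2)[symmetric] by simp
  with a that show thesis by blast
qed

text \<open>The shear \<open>R\<close> is a commutator:
  \<open>S \<circ> T = T \<circ> S \<circ> R\<close>. Left invariance turns the norm of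
  \<open>R\<close> into the distance from \<open>T \<circ> S\<close> to \<open>S \<circ> T\<close>.
  Passing through \<open>S\<close> costs the norm of \<open>T\<close> twice, however large
  \<open>S\<close> is.\<close>

lemma mdist_shear_le:
  fixes \<rho> :: "('n::finite torus \<Rightarrow> 'n torus) metric"
  assumes "mspace \<rho> = Symp0" "bi_invariant \<rho>" "0 < a" "a < 1"
  shows "mdist \<rho> id (torus_drift_shear i 0 (1 / 2) (pi / 2)) \<le> 2 * mdist \<rho> id (torus_drift_shear i a 0 0)"
proof -
  define T where "T = torus_drift_shear i a 0 0"
  \<comment> \<open>Since \<open>sin (x + pi * a) - sin (x - pi * a) = 2 * sin (pi * a) * cos
    x\<close>, this amplitude makes the difference of the waves equal to \<open>cos x / 2\<close>
    for every \<open>a\<close>.\<close>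
  define A where "A = 1 / (4 * sin (pi * a))"
  \<comment> \<open>The phase \<open>- (pi * a)\<close> places the arguments of the wave before and
    after the translation symmetrically around \<open>2 * pi\<close> times the coordinate.\<close>
  define S where "S = torus_drift_shear i 0 A (- (pi * a))"
  define R where "R = torus_drift_shear i 0 (1 / 2) (pi / 2)"
  \<comment> \<open>At amplitude 0 the phase is arbitrary, so it can be matched to what
    \<open>torus_drift_shear_comp\<close> asks for.\<close>
  have T': "T = torus_drift_shear i a 0 d" for d
    by (simp add: T_def torus_drift_shear_def fun_eq_iff drift_shear_def)
  have "sin (pi * a) > 0" using assms(3,4) by (intro sin_gt_zero) auto
  then have A: "A * (sin (x + pi * a) - sin (x - pi * a)) = 1 / 2 * sin (x + pi / 2)" for x
  proof -
    have "sin (x + pi / 2) = cos x" by (simp add: sin_add)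
    with \<open>sin (pi * a) > 0\<close> show ?thesis
      unfolding A_def by (simp add: sin_add sin_diff field_simps)
  qed
  have comm: "S \<circ> T = T \<circ> S \<circ> R"
  proof (rule torus_map_eqI)
    fix z
    have "drift_shear i 0 A (- (pi * a)) (drift_shear i a 0 0 z)
       = drift_shear i a 0 0 (drift_shear i 0 A (- (pi * a)) (drift_shear i 0 (1 / 2) (pi / 2) z))"
      using A[of "2 * pi * fst z $ i"]
      by (simp add: drift_shear_def algebra_simps flip: scaleR_add_left)
    then show "(S \<circ> T) (proj z) = (T \<circ> S \<circ> R) (proj z)"
      unfolding S_def T_def R_def o_apply proj_drift_shear[symmetric] by simp
  qed
  \<comment> \<open>As drift shears, both composites lie in \<open>Symp0\<close>, which invariance
    and the triangle inequality require.\<close>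
  have TS: "T \<circ> S = torus_drift_shear i a A (- (pi * a))"
    using torus_drift_shear_comp[of i a 0 "- (pi * a)" 0 A] T' by (simp add: S_def)
  have ST: "S \<circ> T = torus_drift_shear i a A (pi * a)"
    using torus_drift_shear_comp[of i 0 A "pi * a" a 0] T' by (simp add: S_def)
  have mem: "id \<in> mspace \<rho>" "S \<in> mspace \<rho>" "T \<in> mspace \<rho>" "R \<in> mspace \<rho>"
    "T \<circ> S \<in> mspace \<rho>" "S \<circ> T \<in> mspace \<rho>"
    unfolding TS ST
    by (simp_all add: assms(1) S_def T_def R_def id_in_Symp0 torus_drift_shear_in_Symp0)
  have inv: "mdist \<rho> (\<theta> \<circ> \<phi>) (\<theta> \<circ> \<psi>) = mdist \<rho> \<phi> \<psi>" "mdist \<rho> (\<phi> \<circ> \<theta>) (\<psi> \<circ> \<theta>) = mdist \<rho> \<phi> \<psi>"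
    if "\<phi> \<in> mspace \<rho>" "\<psi> \<in> mspace \<rho>" "\<theta> \<in> mspace \<rho>" for \<phi> \<psi> \<theta>
    using assms(2) that unfolding bi_invariant_def by blast+
  have "mdist \<rho> id R = mdist \<rho> (T \<circ> S) (S \<circ> T)"
    using inv(1)[OF mem(1,4,5)] by (simp only: comm comp_id)
  also have "\<dots> \<le> mdist \<rho> (T \<circ> S) S + mdist \<rho> S (S \<circ> T)"
    using mem by (intro mdist_triangle)
  also have "mdist \<rho> (T \<circ> S) S = mdist \<rho> id T"
    using inv(2)[OF mem(3,1,2)] by (simp only: id_o mdist_commute[of \<rho> T])
  also have "mdist \<rho> S (S \<circ> T) = mdist \<rho> id T"
    using inv(1)[OF mem(1,3,2)] by (simp only: comp_id)
  finally show ?thesis unfolding T_def R_def by linarith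
qed

text \<open>At the origin the wave takes its maximum 1/2, and a shift by 1/2 is not an
  integer.\<close>

lemma shear_neq_id: "torus_drift_shear i 0 (1 / 2) (pi / 2) \<noteq> id"
proof
  assume *: "torus_drift_shear i 0 (1 / 2) (pi / 2) = id"
  have "proj (drift_shear i 0 (1 / 2) (pi / 2) 0) = proj 0"
    unfolding proj_drift_shear * by simp
  then have "snd (drift_shear i 0 (1 / 2) (pi / 2) 0 - 0) $ i \<in> \<int>"
    unfolding proj_eq_iff lattice_def by blast
  then have "(1 / 2 :: real) \<in> \<int>" by (simp add: drift_shear_def)
  then show False using Ints_nonzero_abs_less1[of "1 / 2 :: real"] by simp
qed

theorem theorem3p6:
  "\<not> (\<exists>\<rho> :: ('n::finite torus \<Rightarrow> 'n torus) metric.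
        mspace \<rho> = Symp0 \<and> bi_invariant \<rho> \<and> C1_continuous \<rho>)"
proof
  assume "\<exists>\<rho> :: ('n torus \<Rightarrow> 'n torus) metric.
        mspace \<rho> = Symp0 \<and> bi_invariant \<rho> \<and> C1_continuous \<rho>"
  then obtain \<rho> :: "('n torus \<Rightarrow> 'n torus) metric"
    where \<rho>: "mspace \<rho> = Symp0" "bi_invariant \<rho>" "C1_continuous \<rho>" by blast
  \<comment> \<open>Any coordinate serves; one exists because types are inhabited.\<close>
  fix i :: 'n
  define R where "R = torus_drift_shear i 0 (1 / 2) (pi / 2)"
  \<comment> \<open>The translation and the auxiliary shear vary with \<open>e\<close>, but
    \<open>R\<close> does not, so its norm lies below every positive number.\<close>
  have "mdist \<rho> id R \<le> 0 + e" if "e > 0" for e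
  proof -
    obtain a where "0 < a" "a < 1" "mdist \<rho> id (torus_drift_shear i a 0 0) < e / 2"
      using mdist_translation_small[OF \<rho>(1,3)] \<open>e > 0\<close> half_gt_zero by metis
    with mdist_shear_le[OF \<rho>(1,2), of a i] show ?thesis by (simp add: R_def)
  qed
  then have "mdist \<rho> id R = 0"
    by (meson antisym field_le_epsilon mdist_nonneg)
  moreover have "id \<in> mspace \<rho>" "R \<in> mspace \<rho>"
    by (simp_all add: \<rho>(1) R_def id_in_Symp0 torus_drift_shear_in_Symp0)
  ultimately have "R = id" by simp
  then show False unfolding R_def using shear_neq_id by blast
qed

end
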